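(* The optimal price $p_1^*$ of Formulation 1 in the asymptotic sense (as defined in the context), i.e. the maximizer over $p_b\le p\le\omega_{\min}$ of $F_1(p)=\lim_{N\to\infty}\frac1N f_{1,N}(p)$ (almost sure limit), is obtained by solving $$\max_p\ \ e_1\,\frac{p(\bar\omega-p)}{\alpha}-e_2\,\frac{(\bar\omega-p)^2}{\alpha^2}-e_3\,\frac{p^2}{\alpha^2}\qquad\text{subject to } p_b\le p\le\omega_{\min}.$$
   Context: Non-discriminatory setting: a retailer charges one common price $p$ to $N$ consumers. The preference parameters $\omega_1,\omega_2,\dots$ are i.i.d. uniform on $[\omega_{\min},\omega_{\max}]$, $0<\omega_{\min}<\omega_{\max}$, with mean $\bar\omega$. $\alpha>0$ is a constant, $e_1,e_2,e_3>0$ are weights, and the price limits satisfy $0\le p_b\le\omega_{\min}\le P$. In Formulation 1 consumer $i$'s elastic demand is $x_i=\frac{\omega_i-p}{\alpha}$ with the constraints $x_i\ge0$ for all $i$ and $p_b\le p\le P$, and the objective is $$f_{1,N}(p)=e_1\sum_{i=1}^N p\,x_i-\frac{e_2}{N}\Big(\sum_{i=1}^N x_i\Big)^2-e_3N\Big(\frac p\alpha\Big)^2 .$$ "In the asymptotic sense" means that the objective is replaced by $\lim_{N\to\infty}\frac1N f_{1,N}(p)$, evaluated by the law of large numbers, and that the constraint $p_b\le p\le\min_i\omega_i$ is required for every realization of the $\omega_i$, i.e. it becomes $p_b\le p\le\omega_{\min}$. *)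

theory Defs
  imports "HOL-Probability.Probability"
begin

definition demand :: "real \<Rightarrow> real \<Rightarrow> real \<Rightarrow> real" where
  "demand \<alpha> \<omega> p = (\<omega> - p) / \<alpha>"

text \<open>
  A realization is a sequence \<open>w\<close> of preference parameters; consumers are numbered from 1,
  so \<open>w 0\<close> is never used.
\<close>

definition objective1 ::
  "real \<Rightarrow> real \<Rightarrow> real \<Rightarrow> real \<Rightarrow> nat \<Rightarrow> (nat \<Rightarrow> real) \<Rightarrow> real \<Rightarrow> real" where
  "objective1 e1 e2 e3 \<alpha> N w p =
     e1 * (\<Sum>i=1..N. p * demand \<alpha> (w i) p)
     - e2 / real N * (\<Sum>i=1..N. demand \<alpha> (w i) p)\<^sup>2
     - e3 * real N * (p / \<alpha>)\<^sup>2"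

definition feasible1 ::
  "real \<Rightarrow> real \<Rightarrow> real \<Rightarrow> nat \<Rightarrow> (nat \<Rightarrow> real) \<Rightarrow> real set" where
  "feasible1 \<alpha> p\<^sub>b P N w =
     {p. p\<^sub>b \<le> p \<and> p \<le> P \<and> (\<forall>i\<in>{1..N}. demand \<alpha> (w i) p \<ge> 0)}"

text \<open>
  The asymptotic objective is the deterministic almost sure limit of the objective per consumer.
  The description is meaningful only once such a limit is known to exist.
\<close>

definition asymptotic_objective1 ::
  "'a measure \<Rightarrow> (nat \<Rightarrow> 'a \<Rightarrow> real) \<Rightarrow> real \<Rightarrow> real \<Rightarrow> real \<Rightarrow> real \<Rightarrow> real \<Rightarrow> real" where
  "asymptotic_objective1 M W e1 e2 e3 \<alpha> p =
     (THE L. AE x in M. (\<lambda>N. objective1 e1 e2 e3 \<alpha> N (\<lambda>i. W i x) p / real N) \<longlonglongrightarrow> L)"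

text \<open>
  In the asymptotic problem a price has to be feasible for every number of consumers and every
  realization of their parameters, i.e. for every choice of values in the support
  \<open>{\<omega>min..\<omega>max}\<close> of the uniform distribution.
\<close>

definition asymptotic_feasible1 ::
  "real \<Rightarrow> real \<Rightarrow> real \<Rightarrow> real \<Rightarrow> real \<Rightarrow> real set" where
  "asymptotic_feasible1 \<alpha> p\<^sub>b P \<omega>min \<omega>max =
     {p. \<forall>N w. (\<forall>i\<in>{1..N}. w i \<in> {\<omega>min..\<omega>max}) \<longrightarrow> p \<in> feasible1 \<alpha> p\<^sub>b P N w}"

end

theory Submission
  imports Defs
begin

text \<open>
  Divided by the number of consumers, the objective at a fixed price is a continuous function (a
  quadratic polynomial) of the sample mean of the preference parameters alone. By the strong law of
  large numbers the sample mean tends almost surely to \<open>\<omega>bar\<close>, so the objective per consumer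
  tends almost surely to the same polynomial evaluated at \<open>\<omega>bar\<close>. Since the parameters are
  bounded, Hoeffding's inequality makes the probabilities of a
  fixed deviation from the mean decay geometrically (\<open>deviation_prob_le\<close>), and the first
  Borel--Cantelli lemma turns this into almost sure convergence (\<open>strong_law_bounded\<close>).

  The existence of a deterministic almost sure limit also gives the definite description in the
  asymptotic objective its intended value, because on a probability space two such limits have to
  agree on some outcome (\<open>asymptotic_objective1_eqI\<close>). The feasible set shrinks to
  \<open>{p\<^sub>b..\<omega>min}\<close> because \<open>\<omega>min\<close> itself is a possible parameter value. The limit
  objective has negative leading coefficient in the price, hence is strictly concave and has
  exactly one maximizer on that compact interval.
\<close>

section \<open>A strong law of large numbers for bounded random variables\<close>

text \<open>
  Applied to the sum with deviation \<open>N \<cdot> \<epsilon>\<close>, Hoeffding's exponent becomes linear in \<open>N\<close>, so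
  that the bound is geometric in \<open>N\<close>.
\<close>

lemma (in prob_space) deviation_prob_le:
  fixes X :: "nat \<Rightarrow> 'a \<Rightarrow> real"
  assumes indep: "indep_vars (\<lambda>_. borel) X {1..}"
    and bounded: "\<And>i. i \<ge> 1 \<Longrightarrow> AE x in M. X i x \<in> {a..b}"
    and mean: "\<And>i. i \<ge> 1 \<Longrightarrow> expectation (X i) = \<mu>"
    and "a < b" and "\<epsilon> > 0" and "N > 0"
  shows "prob {x \<in> space M. \<bar>(\<Sum>i=1..N. X i x) / real N - \<mu>\<bar> \<ge> \<epsilon>}
           \<le> 2 * exp (- 2 * \<epsilon>\<^sup>2 / (b - a)\<^sup>2) ^ N"
proof -
  interpret H: Hoeffding_ineq M "{1..N}" X "\<lambda>_. a" "\<lambda>_. b" "\<Sum>i=1..N. expectation (X i)"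
    by unfold_locales (use bounded in \<open>auto intro: indep_vars_subset[OF indep]\<close>)
  have sum_mean: "(\<Sum>i=1..N. expectation (X i)) = real N * \<mu>"
    using mean by simp
  have rescale: "real N * \<epsilon> \<le> \<bar>s - real N * \<mu>\<bar> \<longleftrightarrow> \<epsilon> \<le> \<bar>s / real N - \<mu>\<bar>" for s
  proof -
    have "s / real N - \<mu> = (s - real N * \<mu>) / real N"
      using \<open>N > 0\<close> by (simp add: field_simps)
    then have "\<bar>s / real N - \<mu>\<bar> = \<bar>s - real N * \<mu>\<bar> / real N"
      by (simp only: abs_divide abs_of_nat)
    then show ?thesis
      using \<open>N > 0\<close> by (simp add: field_simps)
  qed
  have "prob {x \<in> space M. \<bar>(\<Sum>i=1..N. X i x) - real N * \<mu>\<bar> \<ge> real N * \<epsilon>}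
          \<le> 2 * exp (- 2 * (real N * \<epsilon>)\<^sup>2 / (\<Sum>i=1..N. (b - a)\<^sup>2))"
    using H.Hoeffding_ineq_abs_ge[of "real N * \<epsilon>"] assms(4-6) by (simp add: sum_mean del: One_nat_def)
  also have "- 2 * (real N * \<epsilon>)\<^sup>2 / (\<Sum>i=1..N. (b - a)\<^sup>2) = real N * (- 2 * \<epsilon>\<^sup>2 / (b - a)\<^sup>2)"
    using assms(4-6) by (simp add: power2_eq_square)
  also have "exp (real N * (- 2 * \<epsilon>\<^sup>2 / (b - a)\<^sup>2)) = exp (- 2 * \<epsilon>\<^sup>2 / (b - a)\<^sup>2) ^ N"
    by (rule exp_of_nat_mult)
  finally show ?thesis
    by (simp only: rescale)
qed

text \<open>
  For each fixed deviation Borel--Cantelli applies; only countably many deviations \<open>1 / (k + 1)\<close>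
  are needed, so the exceptional null sets can be united.
\<close>

theorem (in prob_space) strong_law_bounded:
  fixes X :: "nat \<Rightarrow> 'a \<Rightarrow> real"
  assumes indep: "indep_vars (\<lambda>_. borel) X {1..}"
    and bounded: "\<And>i. i \<ge> 1 \<Longrightarrow> AE x in M. X i x \<in> {a..b}"
    and mean: "\<And>i. i \<ge> 1 \<Longrightarrow> expectation (X i) = \<mu>"
    and "a < b"
  shows "AE x in M. (\<lambda>N. (\<Sum>i=1..N. X i x) / real N) \<longlonglongrightarrow> \<mu>"
proof -
  define S where "S = (\<lambda>N x. (\<Sum>i=1..N. X i x) / real N)"
  have X_measurable: "random_variable borel (X i)" if "i \<in> {1..N}" for i N
    using indep that unfolding indep_vars_def by auto
  have S_measurable [measurable]: "random_variable borel (S N)" for N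
    unfolding S_def by (intro borel_measurable_divide borel_measurable_sum) (auto intro: X_measurable)
  have close: "AE x in M. \<forall>\<^sub>F N in sequentially. \<bar>S N x - \<mu>\<bar> < \<epsilon>" if "\<epsilon> > 0" for \<epsilon>
  proof -
    define A where "A = (\<lambda>N. {x \<in> space M. \<bar>S N x - \<mu>\<bar> \<ge> \<epsilon>})"
    have A_sets: "A N \<in> events" for N
      unfolding A_def by measurable
    have "summable (\<lambda>N. prob (A N))"
    proof (rule summable_comparison_test')
      show "summable (\<lambda>N. 2 * exp (- 2 * \<epsilon>\<^sup>2 / (b - a)\<^sup>2) ^ N)"
        using \<open>a < b\<close> \<open>\<epsilon> > 0\<close> by (intro summable_mult summable_geometric) simp
      show "norm (prob (A N)) \<le> 2 * exp (- 2 * \<epsilon>\<^sup>2 / (b - a)\<^sup>2) ^ N" if "N \<ge> 1" for N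
        using deviation_prob_le[OF assms \<open>\<epsilon> > 0\<close>, of N] that unfolding A_def S_def by simp
    qed
    then have "AE x in M. \<forall>\<^sub>F N in sequentially. x \<in> space M - A N"
      using A_sets by (intro borel_cantelli_AE1) (auto simp: less_top[symmetric])
    then show ?thesis
      by (rule eventually_mono) (auto simp: A_def elim!: eventually_mono)
  qed
  have "AE x in M. \<forall>k. \<forall>\<^sub>F N in sequentially. \<bar>S N x - \<mu>\<bar> < 1 / real (Suc k)"
    unfolding AE_all_countable by (intro allI close) simp
  then have "AE x in M. (\<lambda>N. S N x) \<longlonglongrightarrow> \<mu>"
  proof (rule eventually_mono)
    fix x
    assume small: "\<forall>k. \<forall>\<^sub>F N in sequentially. \<bar>S N x - \<mu>\<bar> < 1 / real (Suc k)"
    show "(\<lambda>N. S N x) \<longlonglongrightarrow> \<mu>"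
    proof (rule tendstoI)
      fix \<epsilon> :: real
      assume "\<epsilon> > 0"
      then obtain k where "1 / real (Suc k) < \<epsilon>"
        by (rule nat_approx_posE)
      with small show "\<forall>\<^sub>F N in sequentially. dist (S N x) \<mu> < \<epsilon>"
        by (auto simp: dist_real_def elim!: allE[of _ k] eventually_mono)
    qed
  qed
  then show ?thesis
    unfolding S_def .
qed

lemma AE_in_interval_of_uniform:
  fixes X :: "'a \<Rightarrow> real"
  assumes [measurable]: "X \<in> borel_measurable M"
    and distr: "distr M borel X = uniform_measure lborel {a..b}"
  shows "AE x in M. X x \<in> {a..b}"
proof -
  have "AE y in uniform_measure lborel {a..b}. y \<in> {a..b}"
    by (rule AE_uniform_measureI) auto
  then have "AE y in distr M borel X. y \<in> {a..b}"
    by (simp only: distr)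
  then show ?thesis
    by (subst (asm) AE_distr_iff) auto
qed

section \<open>The asymptotic problem\<close>

text \<open>
  The definite description is well behaved because an almost sure property holds at some
  outcome of a probability space, where the limit of a sequence is unique.
\<close>

lemma (in prob_space) asymptotic_objective1_eqI:
  assumes "AE x in M. (\<lambda>N. objective1 e1 e2 e3 \<alpha> N (\<lambda>i. W i x) p / real N) \<longlonglongrightarrow> L"
  shows "asymptotic_objective1 M W e1 e2 e3 \<alpha> p = L"
  unfolding asymptotic_objective1_def
proof (rule the_equality)
  fix L'
  assume "AE x in M. (\<lambda>N. objective1 e1 e2 e3 \<alpha> N (\<lambda>i. W i x) p / real N) \<longlonglongrightarrow> L'"
  with assms have "AE x in M. L' = L"
    by eventually_elim (rule LIMSEQ_unique)
  then show "L' = L"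
    by simp
qed (rule assms)

lemma objective1_per_consumer:
  assumes "N > 0"
  shows "objective1 e1 e2 e3 \<alpha> N w p / real N =
    (let m = (\<Sum>i=1..N. w i) / real N
     in e1 * (p * (m - p) / \<alpha>) - e2 * ((m - p)\<^sup>2 / \<alpha>\<^sup>2) - e3 * (p\<^sup>2 / \<alpha>\<^sup>2))"
proof -
  define m where "m = (\<Sum>i=1..N. w i) / real N"
  have total: "(\<Sum>i=1..N. demand \<alpha> (w i) p) = real N * ((m - p) / \<alpha>)"
    using assms by (simp add: demand_def m_def sum_subtractf right_diff_distrib flip: sum_divide_distrib)
  have revenue: "(\<Sum>i=1..N. p * demand \<alpha> (w i) p) = p * (real N * ((m - p) / \<alpha>))"
    by (simp only: total flip: sum_distrib_left)
  show ?thesis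
    using assms unfolding objective1_def revenue total m_def[symmetric] Let_def
    by (simp add: diff_divide_distrib[of _ _ "real N"] power_mult_distrib power_divide
      power2_eq_square[of "real N"])
qed

lemma objective1_per_consumer_tendsto:
  assumes "(\<lambda>N. (\<Sum>i=1..N. w i) / real N) \<longlonglongrightarrow> m"
  shows "(\<lambda>N. objective1 e1 e2 e3 \<alpha> N w p / real N)
    \<longlonglongrightarrow> e1 * (p * (m - p) / \<alpha>) - e2 * ((m - p)\<^sup>2 / \<alpha>\<^sup>2) - e3 * (p\<^sup>2 / \<alpha>\<^sup>2)"
proof (rule Lim_transform_eventually)
  let ?m = "\<lambda>N. (\<Sum>i=1..N. w i) / real N"
  show "(\<lambda>N. e1 * (p * (?m N - p) / \<alpha>) - e2 * ((?m N - p)\<^sup>2 / \<alpha>\<^sup>2) - e3 * (p\<^sup>2 / \<alpha>\<^sup>2))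
      \<longlonglongrightarrow> e1 * (p * (m - p) / \<alpha>) - e2 * ((m - p)\<^sup>2 / \<alpha>\<^sup>2) - e3 * (p\<^sup>2 / \<alpha>\<^sup>2)"
    unfolding divide_inverse[of _ \<alpha>] divide_inverse[of _ "\<alpha>\<^sup>2"]
    by (intro tendsto_intros assms)
  show "\<forall>\<^sub>F N in sequentially.
      e1 * (p * (?m N - p) / \<alpha>) - e2 * ((?m N - p)\<^sup>2 / \<alpha>\<^sup>2) - e3 * (p\<^sup>2 / \<alpha>\<^sup>2)
      = objective1 e1 e2 e3 \<alpha> N w p / real N"
    using eventually_gt_at_top[of 0]
    by eventually_elim (simp add: objective1_per_consumer Let_def)
qed

lemma asymptotic_feasible1_eq:
  assumes "\<alpha> > 0" and "\<omega>min \<le> \<omega>max" and "\<omega>min \<le> P"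
  shows "asymptotic_feasible1 \<alpha> p\<^sub>b P \<omega>min \<omega>max = {p\<^sub>b..\<omega>min}"
proof (rule set_eqI, rule iffI)
  fix p
  assume "p \<in> asymptotic_feasible1 \<alpha> p\<^sub>b P \<omega>min \<omega>max"
  \<comment> \<open>One consumer with the smallest possible parameter gives the binding constraint.\<close>
  then have "p \<in> feasible1 \<alpha> p\<^sub>b P 1 (\<lambda>_. \<omega>min)"
    using assms unfolding asymptotic_feasible1_def by auto
  then show "p \<in> {p\<^sub>b..\<omega>min}"
    using assms by (simp add: feasible1_def demand_def zero_le_divide_iff)
next
  fix p
  assume "p \<in> {p\<^sub>b..\<omega>min}"
  then show "p \<in> asymptotic_feasible1 \<alpha> p\<^sub>b P \<omega>min \<omega>max"
    using assms by (fastforce simp: asymptotic_feasible1_def feasible1_def demand_def)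
qed

text \<open>
  The midpoint of two distinct maximizers would be strictly better than both.
\<close>

lemma ex1_arg_max_midpoint_concave:
  fixes f :: "real \<Rightarrow> real"
  assumes "l \<le> u" and cont: "continuous_on {l..u} f"
    and concave: "\<And>x y. x \<noteq> y \<Longrightarrow> f ((x + y) / 2) > (f x + f y) / 2"
  shows "\<exists>!p. is_arg_max f (\<lambda>p. p \<in> {l..u}) p"
proof -
  obtain p where p: "p \<in> {l..u}" "\<And>q. q \<in> {l..u} \<Longrightarrow> f q \<le> f p"
    using continuous_attains_sup[OF compact_Icc _ cont] \<open>l \<le> u\<close> by auto
  show ?thesis
  proof (rule ex1I)
    show "is_arg_max f (\<lambda>p. p \<in> {l..u}) p"
      using p by (auto simp: is_arg_max_linorder)
  next
    fix q
    assume q: "is_arg_max f (\<lambda>p. p \<in> {l..u}) q"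
    show "q = p"
    proof (rule ccontr)
      assume "q \<noteq> p"
      then have "f ((q + p) / 2) > (f q + f p) / 2"
        by (rule concave)
      moreover have "f p \<le> f q" and "q \<in> {l..u}"
        using p q by (auto simp: is_arg_max_linorder)
      moreover have "f ((q + p) / 2) \<le> f p"
        using p(1) \<open>q \<in> {l..u}\<close> by (intro p(2)) auto
      ultimately have "(f q + f p) / 2 < f p" and "f p \<le> f q"
        by (blast intro: less_le_trans)+
      then show False
        by simp
    qed
  qed
qed

text \<open>
  For a quadratic polynomial the midpoint gain is minus the leading coefficient times a quarter
  of the squared distance, and the leading coefficient is
  \<open>- (e1 / \<alpha> + e2 / \<alpha>\<^sup>2 + e3 / \<alpha>\<^sup>2)\<close>.
\<close>

lemma limit_objective_midpoint_concave:
  fixes e1 e2 e3 \<alpha> m :: real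
  defines "F \<equiv> \<lambda>p. e1 * (p * (m - p) / \<alpha>) - e2 * ((m - p)\<^sup>2 / \<alpha>\<^sup>2) - e3 * (p\<^sup>2 / \<alpha>\<^sup>2)"
  assumes "\<alpha> > 0" and "e1 > 0" and "e2 > 0" and "e3 > 0" and "x \<noteq> y"
  shows "F ((x + y) / 2) > (F x + F y) / 2"
proof -
  define c where "c = e1 / \<alpha> + e2 / \<alpha>\<^sup>2 + e3 / \<alpha>\<^sup>2"
  have "c > 0"
    using assms(2-5) unfolding c_def by (intro add_pos_pos divide_pos_pos) auto
  then have "c / 4 * (x - y)\<^sup>2 > 0"
    using \<open>x \<noteq> y\<close> by simp
  moreover have "F ((x + y) / 2) - (F x + F y) / 2 = c / 4 * (x - y)\<^sup>2"
    using \<open>\<alpha> > 0\<close> unfolding F_def c_def by (simp add: field_simps power2_eq_square)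
  ultimately show ?thesis
    by linarith
qed

theorem mainTheorem5:
  fixes M :: "'a measure" and W :: "nat \<Rightarrow> 'a \<Rightarrow> real"
    and \<omega>min \<omega>max \<omega>bar \<alpha> e1 e2 e3 p\<^sub>b P :: real
  assumes "prob_space M"
    and "0 < \<omega>min" and "\<omega>min < \<omega>max"
    and "prob_space.indep_vars M (\<lambda>_. borel) W {1..}"
    and "\<And>i. i \<ge> 1 \<Longrightarrow> distr M borel (W i) = uniform_measure lborel {\<omega>min..\<omega>max}"
    and "\<And>i. i \<ge> 1 \<Longrightarrow> prob_space.expectation M (W i) = \<omega>bar"
    and "\<alpha> > 0" and "e1 > 0" and "e2 > 0" and "e3 > 0"
    and "0 \<le> p\<^sub>b" and "p\<^sub>b \<le> \<omega>min" and "\<omega>min \<le> P"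
  shows "(\<forall>p. AE x in M. (\<lambda>N. objective1 e1 e2 e3 \<alpha> N (\<lambda>i. W i x) p / real N)
               \<longlonglongrightarrow> asymptotic_objective1 M W e1 e2 e3 \<alpha> p)
    \<and> (\<forall>p. asymptotic_objective1 M W e1 e2 e3 \<alpha> p =
           e1 * (p * (\<omega>bar - p) / \<alpha>) - e2 * ((\<omega>bar - p)\<^sup>2 / \<alpha>\<^sup>2) - e3 * (p\<^sup>2 / \<alpha>\<^sup>2))
    \<and> asymptotic_feasible1 \<alpha> p\<^sub>b P \<omega>min \<omega>max = {p\<^sub>b..\<omega>min}
    \<and> (\<exists>!p. is_arg_max (asymptotic_objective1 M W e1 e2 e3 \<alpha>)
              (\<lambda>p. p \<in> asymptotic_feasible1 \<alpha> p\<^sub>b P \<omega>min \<omega>max) p)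
    \<and> (\<forall>p. is_arg_max (asymptotic_objective1 M W e1 e2 e3 \<alpha>)
              (\<lambda>p. p \<in> asymptotic_feasible1 \<alpha> p\<^sub>b P \<omega>min \<omega>max) p
         \<longleftrightarrow> is_arg_max
              (\<lambda>p. e1 * (p * (\<omega>bar - p) / \<alpha>) - e2 * ((\<omega>bar - p)\<^sup>2 / \<alpha>\<^sup>2) - e3 * (p\<^sup>2 / \<alpha>\<^sup>2))
              (\<lambda>p. p\<^sub>b \<le> p \<and> p \<le> \<omega>min) p)"
proof -
  interpret prob_space M
    by fact
  define F where
    "F = (\<lambda>p. e1 * (p * (\<omega>bar - p) / \<alpha>) - e2 * ((\<omega>bar - p)\<^sup>2 / \<alpha>\<^sup>2) - e3 * (p\<^sup>2 / \<alpha>\<^sup>2))"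
  have "random_variable borel (W i)" if "i \<ge> 1" for i
    using assms(4) that unfolding indep_vars_def by auto
  then have "AE x in M. W i x \<in> {\<omega>min..\<omega>max}" if "i \<ge> 1" for i
    using AE_in_interval_of_uniform assms(5) that by blast
  then have "AE x in M. (\<lambda>N. (\<Sum>i=1..N. W i x) / real N) \<longlonglongrightarrow> \<omega>bar"
    using assms(3,4,6) by (intro strong_law_bounded) auto
  then have limit:
    "AE x in M. (\<lambda>N. objective1 e1 e2 e3 \<alpha> N (\<lambda>i. W i x) p / real N) \<longlonglongrightarrow> F p" for p
    unfolding F_def by (rule eventually_mono) (rule objective1_per_consumer_tendsto)
  then have objective: "asymptotic_objective1 M W e1 e2 e3 \<alpha> = F"
    by (intro ext asymptotic_objective1_eqI)
  have feasible: "asymptotic_feasible1 \<alpha> p\<^sub>b P \<omega>min \<omega>max = {p\<^sub>b..\<omega>min}"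
    using assms by (intro asymptotic_feasible1_eq) auto
  have "\<exists>!p. is_arg_max F (\<lambda>p. p \<in> {p\<^sub>b..\<omega>min}) p"
  proof (rule ex1_arg_max_midpoint_concave)
    show "continuous_on {p\<^sub>b..\<omega>min} F"
      unfolding F_def using assms(7) by (intro continuous_intros) auto
    show "F ((x + y) / 2) > (F x + F y) / 2" if "x \<noteq> y" for x y
      unfolding F_def using assms that by (intro limit_objective_midpoint_concave) auto
  qed fact
  then show ?thesis
    unfolding objective feasible F_def[symmetric] using limit by (simp add: F_def)
qed

end
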